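(* Let $\Omega\subset\mathbb{R}^3$ be a bounded domain. If $\mathsf{B}\in L^\infty(\Omega)^{3\times3}$ and $(\det\mathsf{B})^{-1}\in L^\infty(\Omega)$, then $\mathsf{B}^{-1}\in L^\infty(\Omega)^{3\times3}$. If, moreover, $\mu_1,\mu_2,\mu_3\in L^\infty(\Omega)$, then $\mathcal{A}(\mathsf{B})\in L^\infty(\Omega)^{3\times3}$.
   Context: $\mathsf{B}$ is a $3\times3$-matrix-valued function on $\Omega$, $\mathsf{B}^{-1}$ is its pointwise matrix inverse, and $\mathcal{A}(\mathsf{B})=\mu_1\mathsf{I}+\mu_2\mathsf{B}+\mu_3\mathsf{B}^{-1}$, where $\mathsf{I}$ is the identity matrix and $\mu_1,\mu_2,\mu_3$ are scalar fields on $\Omega$. *)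

theory Defs
  imports "HOL-Analysis.Analysis"
begin

(* Elements of the Lebesgue space are handled through representatives: total functions of which
   only the values on \<Omega>, up to a Lebesgue null set, matter.  Membership is invariant under
   changing the function on a null set because lebesgue_on \<Omega> is complete (for measurable \<Omega>). *)
definition Linf :: "(real^3) set \<Rightarrow> (real^3 \<Rightarrow> real) set" where
  "Linf \<Omega> = {f. f \<in> borel_measurable (lebesgue_on \<Omega>) \<and>
                 (\<exists>C. AE x in lebesgue_on \<Omega>. \<bar>f x\<bar> \<le> C)}"

definition Linf_mat :: "(real^3) set \<Rightarrow> (real^3 \<Rightarrow> real^3^3) set" where
  "Linf_mat \<Omega> = {B. \<forall>i j. (\<lambda>x. B x $ i $ j) \<in> Linf \<Omega>}"

(* Pitfall: inverse 0 = 0 and matrix_inv of a singular matrix is an unspecified matrix, so the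
   expressions "inverse (det (B x))" and "matrix_inv (B x)" only have their mathematical meaning
   together with det (B x) \<noteq> 0, respectively invertible (B x), for almost every x in \<Omega>. *)
definition \<A> ::
  "(real^3 \<Rightarrow> real) \<Rightarrow> (real^3 \<Rightarrow> real) \<Rightarrow> (real^3 \<Rightarrow> real) \<Rightarrow> (real^3 \<Rightarrow> real^3^3) \<Rightarrow> real^3 \<Rightarrow> real^3^3"
  where
  "\<A> \<mu>1 \<mu>2 \<mu>3 B x = \<mu>1 x *\<^sub>R mat 1 + \<mu>2 x *\<^sub>R B x + \<mu>3 x *\<^sub>R matrix_inv (B x)"

end

theory Submission
  imports Defs
begin

text \<open>
  Where \<open>det B\<close> does not vanish, Cramer's rule writes each entry of the inverse matrix as
  \<open>(det B)\<^sup>-\<^sup>1\<close> times the determinant of a matrix whose entries are entries of \<open>B\<close>, zeros or ones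
  (\<open>matrix_inv_entry_cramer\<close>).  The essentially bounded functions form an algebra containing the
  constants, so a determinant, being a polynomial in the entries, stays in \<open>L\<^sup>\<infinity>\<close> together with
  the entries (\<open>Linf_det\<close>).  The remaining factor \<open>(det B)\<^sup>-\<^sup>1\<close> is in \<open>L\<^sup>\<infinity>\<close> by hypothesis.

  Cramer's rule holds only almost everywhere.  To conclude that the chosen representative
  \<open>matrix_inv (B x)\<close> itself is measurable, despite its arbitrary values where \<open>B x\<close> is singular,
  one needs completeness of Lebesgue measure (\<open>Linf_cong_AE\<close>).
\<close>

lemma Linf_const: "(\<lambda>x. c) \<in> Linf \<Omega>"
  unfolding Linf_def by auto

lemma Linf_add:
  assumes "f \<in> Linf \<Omega>" "g \<in> Linf \<Omega>"
  shows "(\<lambda>x. f x + g x) \<in> Linf \<Omega>"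
proof -
  obtain C D where C: "AE x in lebesgue_on \<Omega>. \<bar>f x\<bar> \<le> C"
    and D: "AE x in lebesgue_on \<Omega>. \<bar>g x\<bar> \<le> D"
    using assms unfolding Linf_def by blast
  have "AE x in lebesgue_on \<Omega>. \<bar>f x + g x\<bar> \<le> C + D"
    using C D by eventually_elim linarith
  then show ?thesis
    using assms unfolding Linf_def by auto
qed

lemma Linf_mult:
  assumes "f \<in> Linf \<Omega>" "g \<in> Linf \<Omega>"
  shows "(\<lambda>x. f x * g x) \<in> Linf \<Omega>"
proof -
  obtain C D where C: "AE x in lebesgue_on \<Omega>. \<bar>f x\<bar> \<le> C"
    and D: "AE x in lebesgue_on \<Omega>. \<bar>g x\<bar> \<le> D"
    using assms unfolding Linf_def by blast
  have "AE x in lebesgue_on \<Omega>. \<bar>f x * g x\<bar> \<le> C * D"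
    using C D by eventually_elim (simp add: abs_mult mult_mono')
  then show ?thesis
    using assms unfolding Linf_def by auto
qed

lemma Linf_sum:
  assumes "\<And>i. i \<in> I \<Longrightarrow> f i \<in> Linf \<Omega>"
  shows "(\<lambda>x. \<Sum>i\<in>I. f i x) \<in> Linf \<Omega>"
  using assms
  by (induction I rule: infinite_finite_induct) (simp_all add: Linf_const Linf_add)

lemma Linf_prod:
  assumes "\<And>i. i \<in> I \<Longrightarrow> f i \<in> Linf \<Omega>"
  shows "(\<lambda>x. \<Prod>i\<in>I. f i x) \<in> Linf \<Omega>"
  using assms
  by (induction I rule: infinite_finite_induct) (simp_all add: Linf_const Linf_mult)

text \<open>
  The Leibniz formula is a polynomial in the entries, so the algebra structure suffices, in any
  dimension.
\<close>

lemma Linf_det: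
  fixes A :: "real^3 \<Rightarrow> real^'n^'n"
  assumes "\<And>i j. (\<lambda>x. A x $ i $ j) \<in> Linf \<Omega>"
  shows "(\<lambda>x. det (A x)) \<in> Linf \<Omega>"
  unfolding det_def by (intro Linf_sum Linf_mult Linf_prod Linf_const assms)

text \<open>
  Completeness makes every function that agrees almost everywhere with a measurable one measurable.
  Extension by zero outside \<open>\<Omega>\<close> reduces this to Lebesgue measure on the whole space.
\<close>

lemma Linf_cong_AE:
  assumes \<Omega>: "\<Omega> \<in> sets lebesgue"
    and f: "f \<in> Linf \<Omega>" and eq: "AE x in lebesgue_on \<Omega>. f x = g x"
  shows "g \<in> Linf \<Omega>"
proof -
  have "(\<lambda>x. if x \<in> \<Omega> then f x else 0) \<in> borel_measurable lebesgue"
    using f \<Omega> by (simp add: Linf_def borel_measurable_if)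
  moreover have "AE x in lebesgue. x \<in> \<Omega> \<longrightarrow> f x = g x"
    using eq \<Omega> by (simp add: AE_restrict_space_iff)
  then have "AE x in lebesgue. (if x \<in> \<Omega> then f x else 0) = (if x \<in> \<Omega> then g x else 0)"
    by eventually_elim simp
  ultimately have "(\<lambda>x. if x \<in> \<Omega> then g x else 0) \<in> borel_measurable lebesgue"
    by (rule borel_measurable_AE)
  then have meas: "g \<in> borel_measurable (lebesgue_on \<Omega>)"
    by (rule borel_measurable_if_D)
  obtain C where "AE x in lebesgue_on \<Omega>. \<bar>f x\<bar> \<le> C"
    using f unfolding Linf_def by blast
  then have "AE x in lebesgue_on \<Omega>. \<bar>g x\<bar> \<le> C"
    using eq by eventually_elim simp
  with meas show ?thesis
    unfolding Linf_def by blast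
qed

text \<open>
  Column \<open>l\<close> of the inverse solves \<open>A *v x = axis l 1\<close>, and Cramer's rule gives its entries.
\<close>

lemma matrix_inv_entry_cramer:
  fixes A :: "'a::field^'n^'n"
  assumes "det A \<noteq> 0"
  shows "matrix_inv A $ k $ l =
    det (\<chi> i j. if j = k then axis l 1 $ i else A $ i $ j) * inverse (det A)"
proof -
  have "\<exists>A'. A ** A' = mat 1 \<and> A' ** A = mat 1"
    using assms invertible_det_nz unfolding invertible_def by blast
  then have "A ** matrix_inv A = mat 1"
    unfolding matrix_inv_def by (rule someI2_ex) blast
  then have "A *v (matrix_inv A *v axis l 1) = axis l 1"
    by (simp add: matrix_vector_mul_assoc)
  then have "(matrix_inv A *v axis l 1) $ k =
      det (\<chi> i j. if j = k then axis l 1 $ i else A $ i $ j) / det A"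
    by (simp add: cramer[OF assms])
  moreover have "(matrix_inv A *v axis l 1) $ k = matrix_inv A $ k $ l"
    by (simp add: matrix_vector_mult_def axis_def if_distrib cong: if_cong)
  ultimately show ?thesis
    by (simp add: divide_inverse)
qed

lemma Linf_mat_matrix_inv:
  assumes \<Omega>: "\<Omega> \<in> sets lebesgue"
    and B: "B \<in> Linf_mat \<Omega>"
    and nz: "AE x in lebesgue_on \<Omega>. det (B x) \<noteq> 0"
    and inv: "(\<lambda>x. inverse (det (B x))) \<in> Linf \<Omega>"
  shows "(\<lambda>x. matrix_inv (B x)) \<in> Linf_mat \<Omega>"
  unfolding Linf_mat_def
proof (intro CollectI allI)
  fix k l :: 3
  let ?M = "\<lambda>x. (\<chi> i j. if j = k then axis l 1 $ i else B x $ i $ j) :: real^3^3"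
  have "(\<lambda>x. ?M x $ i $ j) \<in> Linf \<Omega>" for i j
    using B by (cases "j = k") (simp_all add: Linf_const Linf_mat_def)
  then have "(\<lambda>x. det (?M x) * inverse (det (B x))) \<in> Linf \<Omega>"
    by (intro Linf_mult Linf_det inv)
  moreover have "AE x in lebesgue_on \<Omega>.
      det (?M x) * inverse (det (B x)) = matrix_inv (B x) $ k $ l"
    using nz by eventually_elim (simp add: matrix_inv_entry_cramer)
  ultimately show "(\<lambda>x. matrix_inv (B x) $ k $ l) \<in> Linf \<Omega>"
    by (rule Linf_cong_AE[OF \<Omega>])
qed

lemma Linf_mat_\<A>:
  assumes "\<mu>1 \<in> Linf \<Omega>" "\<mu>2 \<in> Linf \<Omega>" "\<mu>3 \<in> Linf \<Omega>"
    and "B \<in> Linf_mat \<Omega>" "(\<lambda>x. matrix_inv (B x)) \<in> Linf_mat \<Omega>"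
  shows "\<A> \<mu>1 \<mu>2 \<mu>3 B \<in> Linf_mat \<Omega>"
  using assms unfolding Linf_mat_def \<A>_def
  by (simp add: Linf_add Linf_mult Linf_const)

theorem proposition5p3:
  fixes \<Omega> :: "(real^3) set" and B :: "real^3 \<Rightarrow> real^3^3"
  assumes "open \<Omega>" and "connected \<Omega>" and "\<Omega> \<noteq> {}" and "bounded \<Omega>"
    and "B \<in> Linf_mat \<Omega>"
    and "AE x in lebesgue_on \<Omega>. det (B x) \<noteq> 0"
    and "(\<lambda>x. inverse (det (B x))) \<in> Linf \<Omega>"
  shows "(AE x in lebesgue_on \<Omega>. invertible (B x)) \<and>
         (\<lambda>x. matrix_inv (B x)) \<in> Linf_mat \<Omega> \<and>
         (\<forall>\<mu>1 \<mu>2 \<mu>3. \<mu>1 \<in> Linf \<Omega> \<longrightarrow> \<mu>2 \<in> Linf \<Omega> \<longrightarrow> \<mu>3 \<in> Linf \<Omega> \<longrightarrow>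
            \<A> \<mu>1 \<mu>2 \<mu>3 B \<in> Linf_mat \<Omega>)"
proof -
  have "\<Omega> \<in> sets lebesgue"
    using assms(1) by (intro sets_completionI_sets) simp
  then have inv: "(\<lambda>x. matrix_inv (B x)) \<in> Linf_mat \<Omega>"
    using assms(5-7) by (rule Linf_mat_matrix_inv)
  show ?thesis
    using assms(5,6) inv by (simp add: invertible_det_nz Linf_mat_\<A>)
qed

end
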